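(* Let $n$ be a positive integer, let $\mathcal{H}_i$ be a reproducing kernel Hilbert space on a nonempty set $\Omega_i$ for $i=1,\dots,n$, and let $A=[A_{ij}]$ be an $n\times n$ operator matrix on $\bigoplus_{i=1}^n\mathcal{H}_i$ with $A_{ij}\in\mathbb{B}(\mathcal{H}_j,\mathcal{H}_i)$, $1\le i,j\le n$. Then $$\|A\|_{ber}\le\big\|\big[\|A_{ij}\|_{ber}\big]\big\|,$$ where the right-hand side is the operator norm (on $\mathbb{C}^n$ with the Euclidean norm) of the $n\times n$ matrix whose $(i,j)$ entry is $\|A_{ij}\|_{ber}$.
   Context: A reproducing kernel Hilbert space (RKHS) $\mathcal{H}$ on a nonempty set $\Omega$ is a complex Hilbert space of complex-valued functions on $\Omega$ for which every evaluation $f\mapsto f(\lambda)$, $\lambda\in\Omega$, is a bounded linear functional; $k_\lambda\in\mathcal{H}$ is the unique element with $f(\lambda)=\langle f,k_\lambda\rangle$ for all $f\in\mathcal{H}$, it is assumed that $k_\lambda\neq0$, and $\hat k_\lambda=k_\lambda/\|k_\lambda\|$. $\mathbb{B}(\mathcal{H}_j,\mathcal{H}_i)$ denotes the bounded linear operators from $\mathcal{H}_j$ to $\mathcal{H}_i$. For $T\in\mathbb{B}(\mathcal{H}_j,\mathcal{H}_i)$ the Berezin norm is $\|T\|_{ber}=\sup\{|\langle T\hat k_\lambda,\hat k_\mu\rangle|:\lambda\in\Omega_j,\ \mu\in\Omega_i\}$, where $\hat k_\lambda$ and $\hat k_\mu$ are the normalized kernels of $\mathcal{H}_j$ and $\mathcal{H}_i$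 respectively. The direct sum $\bigoplus_{i=1}^n\mathcal{H}_i$ is treated as an RKHS on $\Omega_1\times\cdots\times\Omega_n$ whose kernel at $\lambda=(\lambda_1,\dots,\lambda_n)$ is the vector $(k_{\lambda_1},\dots,k_{\lambda_n})$, with normalization $\hat k_{\lambda}=(k_{\lambda_1},\dots,k_{\lambda_n})/\big(\sum_i\|k_{\lambda_i}\|^2\big)^{1/2}$; thus $\|A\|_{ber}=\sup|\langle A\hat k_{\lambda},\hat k_{\mu}\rangle|$ over $\lambda,\mu\in\Omega_1\times\cdots\times\Omega_n$. The operator matrix acts by $(Ax)_i=\sum_jA_{ij}x_j$. *)

theory Defs
  imports "HOL-Analysis.Analysis"
begin

text \<open>
  A complex inner product space of complex-valued functions on the set \<open>pts\<close>. Functions on \<open>pts\<close> are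
  represented by total functions that vanish outside \<open>pts\<close> (see \<open>rkhs\<close> below), so that
  the vector space operations are the pointwise ones. Taking the point sets inside a common type
  \<open>'a\<close> is no restriction for a finite family of spaces: \<open>'a\<close> can be a disjoint union.
\<close>

record 'a fun_space =
  pts :: "'a set"
  funs :: "('a \<Rightarrow> complex) set"
  ip :: "('a \<Rightarrow> complex) \<Rightarrow> ('a \<Rightarrow> complex) \<Rightarrow> complex"

definition fnorm :: "'a fun_space \<Rightarrow> ('a \<Rightarrow> complex) \<Rightarrow> real" where
  "fnorm S f = sqrt (Re (ip S f f))"

text \<open>
  In a reproducing kernel Hilbert space the description below is proper by the Riesz
  representation theorem; the inner product is linear in its first argument.
\<close>

definition rep_kernel :: "'a fun_space \<Rightarrow> 'a \<Rightarrow> 'a \<Rightarrow> complex" where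
  "rep_kernel S p = (THE k. k \<in> funs S \<and> (\<forall>f\<in>funs S. f p = ip S f k))"

definition nkernel :: "'a fun_space \<Rightarrow> 'a \<Rightarrow> 'a \<Rightarrow> complex" where
  "nkernel S p = (\<lambda>q. rep_kernel S p q / complex_of_real (fnorm S (rep_kernel S p)))"

locale rkhs =
  fixes S :: "'a fun_space"
  assumes pts_nonempty: "pts S \<noteq> {}"
    and vanish_outside: "\<And>f p. f \<in> funs S \<Longrightarrow> p \<notin> pts S \<Longrightarrow> f p = 0"
    and zero_closed: "(\<lambda>p. 0) \<in> funs S"
    and add_closed: "\<And>f g. f \<in> funs S \<Longrightarrow> g \<in> funs S \<Longrightarrow> (\<lambda>p. f p + g p) \<in> funs S"
    and scale_closed: "\<And>c f. f \<in> funs S \<Longrightarrow> (\<lambda>p. c * f p) \<in> funs S"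
    and ip_add: "\<And>f g h. f \<in> funs S \<Longrightarrow> g \<in> funs S \<Longrightarrow> h \<in> funs S \<Longrightarrow>
        ip S (\<lambda>p. f p + g p) h = ip S f h + ip S g h"
    and ip_scale: "\<And>c f g. f \<in> funs S \<Longrightarrow> g \<in> funs S \<Longrightarrow>
        ip S (\<lambda>p. c * f p) g = c * ip S f g"
    and ip_cnj: "\<And>f g. f \<in> funs S \<Longrightarrow> g \<in> funs S \<Longrightarrow> ip S g f = cnj (ip S f g)"
    and ip_pos: "\<And>f. f \<in> funs S \<Longrightarrow> f \<noteq> (\<lambda>p. 0) \<Longrightarrow> 0 < Re (ip S f f)"
    and complete: "\<And>F :: nat \<Rightarrow> 'a \<Rightarrow> complex. (\<And>m. F m \<in> funs S) \<Longrightarrow>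
        (\<And>e. e > 0 \<Longrightarrow> \<exists>N. \<forall>m\<ge>N. \<forall>n\<ge>N. fnorm S (\<lambda>p. F m p - F n p) < e) \<Longrightarrow>
        \<exists>f\<in>funs S. (\<lambda>m. fnorm S (\<lambda>p. F m p - f p)) \<longlonglongrightarrow> 0"
    and eval_bounded: "\<And>p. p \<in> pts S \<Longrightarrow> \<exists>C. \<forall>f\<in>funs S. cmod (f p) \<le> C * fnorm S f"
    and kernel_nonzero: "\<And>p. p \<in> pts S \<Longrightarrow> rep_kernel S p \<noteq> (\<lambda>q. 0)"

definition bounded_op ::
  "'a fun_space \<Rightarrow> 'a fun_space \<Rightarrow> (('a \<Rightarrow> complex) \<Rightarrow> ('a \<Rightarrow> complex)) \<Rightarrow> bool" where
  "bounded_op S S' T \<longleftrightarrow>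
     (\<forall>f\<in>funs S. T f \<in> funs S') \<and>
     (\<forall>f\<in>funs S. \<forall>g\<in>funs S. T (\<lambda>p. f p + g p) = (\<lambda>p. T f p + T g p)) \<and>
     (\<forall>c. \<forall>f\<in>funs S. T (\<lambda>p. c * f p) = (\<lambda>p. c * T f p)) \<and>
     (\<exists>C. \<forall>f\<in>funs S. fnorm S' (T f) \<le> C * fnorm S f)"

definition berezin_norm ::
  "'a fun_space \<Rightarrow> 'a fun_space \<Rightarrow> (('a \<Rightarrow> complex) \<Rightarrow> ('a \<Rightarrow> complex)) \<Rightarrow> real" where
  "berezin_norm S S' T =
     Sup {cmod (ip S' (T (nkernel S p)) (nkernel S' q)) | p q. p \<in> pts S \<and> q \<in> pts S'}"

text \<open>
  The direct sum of a family \<open>H\<close> consists of the tuples \<open>x\<close> with \<open>x i \<in> funs (H i)\<close>. Its kernel at a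
  point \<open>l\<close> of the product of the point sets is by convention the tuple of the kernels at the
  \<open>l i\<close>; a tuple \<open>x\<close> is not itself regarded as a function on that product.
\<close>

definition dsum_ip ::
  "('n::finite \<Rightarrow> 'a fun_space) \<Rightarrow> ('n \<Rightarrow> 'a \<Rightarrow> complex) \<Rightarrow> ('n \<Rightarrow> 'a \<Rightarrow> complex) \<Rightarrow> complex" where
  "dsum_ip H x y = (\<Sum>i\<in>UNIV. ip (H i) (x i) (y i))"

definition dsum_pts :: "('n::finite \<Rightarrow> 'a fun_space) \<Rightarrow> ('n \<Rightarrow> 'a) set" where
  "dsum_pts H = {l. \<forall>i. l i \<in> pts (H i)}"

definition dsum_nkernel ::
  "('n::finite \<Rightarrow> 'a fun_space) \<Rightarrow> ('n \<Rightarrow> 'a) \<Rightarrow> ('n \<Rightarrow> 'a \<Rightarrow> complex)" where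
  "dsum_nkernel H l = (\<lambda>i q. rep_kernel (H i) (l i) q /
     complex_of_real (sqrt (\<Sum>j\<in>UNIV. (fnorm (H j) (rep_kernel (H j) (l j)))\<^sup>2)))"

definition dsum_berezin_norm ::
  "('n::finite \<Rightarrow> 'a fun_space) \<Rightarrow> (('n \<Rightarrow> 'a \<Rightarrow> complex) \<Rightarrow> ('n \<Rightarrow> 'a \<Rightarrow> complex)) \<Rightarrow> real" where
  "dsum_berezin_norm H T =
     Sup {cmod (dsum_ip H (T (dsum_nkernel H l)) (dsum_nkernel H m)) | l m.
            l \<in> dsum_pts H \<and> m \<in> dsum_pts H}"

definition op_matrix ::
  "('n::finite \<Rightarrow> 'n \<Rightarrow> ('a \<Rightarrow> complex) \<Rightarrow> ('a \<Rightarrow> complex)) \<Rightarrow>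
     ('n \<Rightarrow> 'a \<Rightarrow> complex) \<Rightarrow> ('n \<Rightarrow> 'a \<Rightarrow> complex)" where
  "op_matrix A x = (\<lambda>i p. \<Sum>j\<in>UNIV. A i j (x j) p)"

end

theory Submission imports Defs begin

text \<open>
  Let \<open>k\<^sub>j\<close> and \<open>k'\<^sub>i\<close> be the kernels of the summands at the components of two points of the
  product. With \<open>a\<^sub>j = \<parallel>k\<^sub>j\<parallel> / sqrt (\<Sum>\<^sub>r \<parallel>k\<^sub>r\<parallel>\<^sup>2)\<close> and \<open>b\<^sub>i\<close> likewise from \<open>k'\<close>, the form of \<open>A\<close> at the
  normalized kernels is the sum of the \<open>b\<^sub>i a\<^sub>j \<langle>A\<^sub>i\<^sub>j k\<^sub>j, k'\<^sub>i\<rangle> / (\<parallel>k\<^sub>j\<parallel> \<parallel>k'\<^sub>i\<parallel>)\<close>. Its modulus is at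
  most \<open>\<langle>B a, b\<rangle>\<close>, where \<open>B\<close> is the matrix of Berezin norms and \<open>a\<close>, \<open>b\<close> are unit vectors.
\<close>

section \<open>Inner products, norms and the Cauchy-Schwarz inequality in one space\<close>

context rkhs
begin

lemma diff_closed: "f \<in> funs S \<Longrightarrow> g \<in> funs S \<Longrightarrow> (\<lambda>p. f p - g p) \<in> funs S"
  using add_closed[OF _ scale_closed[of g "-1"], of f] by simp

lemma ip_add_right:
  assumes "f \<in> funs S" "g \<in> funs S" "h \<in> funs S"
  shows "ip S h (\<lambda>p. f p + g p) = ip S h f + ip S h g"
proof -
  have "ip S h (\<lambda>p. f p + g p) = cnj (ip S (\<lambda>p. f p + g p) h)"
    using assms by (intro ip_cnj add_closed)
  also have "\<dots> = cnj (ip S f h) + cnj (ip S g h)"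
    using assms by (simp add: ip_add)
  also have "\<dots> = ip S h f + ip S h g"
    using ip_cnj[OF assms(1,3)] ip_cnj[OF assms(2,3)] by simp
  finally show ?thesis .
qed

lemma ip_scale_right:
  assumes "f \<in> funs S" "g \<in> funs S"
  shows "ip S f (\<lambda>p. c * g p) = cnj c * ip S f g"
proof -
  have "ip S f (\<lambda>p. c * g p) = cnj (ip S (\<lambda>p. c * g p) f)"
    using assms by (intro ip_cnj scale_closed)
  also have "\<dots> = cnj c * cnj (ip S g f)"
    using assms by (simp add: ip_scale)
  also have "\<dots> = cnj c * ip S f g"
    using ip_cnj[OF assms(2,1)] by simp
  finally show ?thesis .
qed

lemma ip_diff:
  assumes "f \<in> funs S" "g \<in> funs S" "h \<in> funs S"
  shows "ip S (\<lambda>p. f p - g p) h = ip S f h - ip S g h"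
  using ip_add[OF assms(1) scale_closed[OF assms(2), of "-1"] assms(3)]
    ip_scale[OF assms(2,3), of "-1"] by simp

lemma ip_zero: "g \<in> funs S \<Longrightarrow> ip S (\<lambda>p. 0) g = 0"
  using ip_scale[OF zero_closed, of g 0] by simp

text \<open>Membership and additivity go through one induction, because \<open>ip_add\<close> at
  each step requires the partial sum to lie in the space.\<close>

lemma ip_sum:
  assumes "finite J" "\<And>j. j \<in> J \<Longrightarrow> f j \<in> funs S" "g \<in> funs S"
  shows "(\<lambda>p. \<Sum>j\<in>J. f j p) \<in> funs S \<and> ip S (\<lambda>p. \<Sum>j\<in>J. f j p) g = (\<Sum>j\<in>J. ip S (f j) g)"
  using assms(1,2)
proof induction
  case empty
  then show ?case using zero_closed ip_zero assms(3) by simp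
next
  case (insert x F)
  then show ?case
    using add_closed[of "f x" "\<lambda>p. \<Sum>j\<in>F. f j p"] ip_add[of "f x" "\<lambda>p. \<Sum>j\<in>F. f j p" g] assms(3)
    by simp
qed

lemma ip_self_nonneg: "f \<in> funs S \<Longrightarrow> 0 \<le> Re (ip S f f)"
  using ip_pos[of f] ip_zero[of f] by (cases "f = (\<lambda>p. 0)") force+

lemma fnorm_nonneg: "f \<in> funs S \<Longrightarrow> 0 \<le> fnorm S f"
  by (simp add: fnorm_def ip_self_nonneg)

lemma fnorm_sq: "f \<in> funs S \<Longrightarrow> (fnorm S f)\<^sup>2 = Re (ip S f f)"
  by (simp add: fnorm_def ip_self_nonneg)

text \<open>The cross term keeps the perturbation \<open>g\<close> in the linear slot, so that a
  scalar factor on it comes out by \<open>ip_scale\<close>.\<close>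

lemma fnorm_sq_add:
  assumes "f \<in> funs S" "g \<in> funs S"
  shows "(fnorm S (\<lambda>p. f p + g p))\<^sup>2 = (fnorm S f)\<^sup>2 + 2 * Re (ip S g f) + (fnorm S g)\<^sup>2"
proof -
  have "Re (ip S f g) = Re (ip S g f)"
    using ip_cnj[OF assms(2,1)] by simp
  then show ?thesis
    using assms by (simp add: fnorm_sq add_closed ip_add ip_add_right)
qed

lemma fnorm_scale:
  assumes "f \<in> funs S"
  shows "fnorm S (\<lambda>p. c * f p) = cmod c * fnorm S f"
proof -
  have "ip S (\<lambda>p. c * f p) (\<lambda>p. c * f p) = complex_of_real ((cmod c)\<^sup>2) * ip S f f"
    unfolding complex_norm_square using assms by (simp add: ip_scale ip_scale_right scale_closed)
  then have "Re (ip S (\<lambda>p. c * f p) (\<lambda>p. c * f p)) = (cmod c)\<^sup>2 * Re (ip S f f)"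
    by simp
  then show ?thesis
    by (simp add: fnorm_def real_sqrt_mult)
qed

text \<open>The squared norm of \<open>g + t f\<close> is a nonnegative quadratic polynomial in the
  real variable \<open>t\<close>. If its leading coefficient vanishes, \<open>f\<close> is zero by
  definiteness.\<close>

lemma Re_ip_le:
  assumes "f \<in> funs S" "g \<in> funs S"
  shows "Re (ip S f g) \<le> fnorm S f * fnorm S g"
proof -
  have quad: "0 \<le> (fnorm S g)\<^sup>2 + 2 * (t * Re (ip S f g)) + t\<^sup>2 * (fnorm S f)\<^sup>2" for t :: real
  proof -
    have "0 \<le> (fnorm S (\<lambda>p. g p + complex_of_real t * f p))\<^sup>2" by simp
    also have "\<dots> = (fnorm S g)\<^sup>2 + 2 * (t * Re (ip S f g)) + t\<^sup>2 * (fnorm S f)\<^sup>2"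
      using fnorm_sq_add[OF assms(2) scale_closed[OF assms(1), of "complex_of_real t"]] assms
      by (simp add: ip_scale fnorm_scale power_mult_distrib)
    finally show ?thesis .
  qed
  show ?thesis
  proof (cases "fnorm S f = 0")
    case True
    show ?thesis
    proof (cases "f = (\<lambda>p. 0)")
      case True
      then show ?thesis using assms ip_zero fnorm_nonneg by simp
    next
      case False
      then show ?thesis using True ip_pos[OF assms(1) False] fnorm_sq[OF assms(1)] by simp
    qed
  next
    case False
    let ?r = "Re (ip S f g)"
    have pos: "0 < (fnorm S f)\<^sup>2" using False by simp
    define n where "n = (fnorm S f)\<^sup>2"
    \<comment> \<open>The value \<open>t = - r / n\<close> is the minimizer of the
      quadratic.\<close>
    have "2 * (- ?r / n * ?r) + (- ?r / n)\<^sup>2 * n = - (?r\<^sup>2 / n)"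
      using pos by (simp add: n_def[symmetric] power2_eq_square)
    then have "?r\<^sup>2 / n \<le> (fnorm S g)\<^sup>2"
      using quad[of "- ?r / n"] unfolding n_def[symmetric] by linarith
    then have "?r\<^sup>2 \<le> (fnorm S f * fnorm S g)\<^sup>2"
      using pos unfolding power_mult_distrib n_def[symmetric]
      by (simp add: pos_divide_le_eq mult.commute)
    then show ?thesis
      by (rule power2_le_imp_le) (simp add: fnorm_nonneg assms)
  qed
qed

text \<open>Rotating \<open>f\<close> by the unimodular scalar that makes the inner product real and
  nonnegative reduces the modulus to the real part.\<close>

lemma cmod_ip_le:
  assumes "f \<in> funs S" "g \<in> funs S"
  shows "cmod (ip S f g) \<le> fnorm S f * fnorm S g"
proof (cases "ip S f g = 0")
  case True
  then show ?thesis using assms fnorm_nonneg by simp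
next
  case False
  define c where "c = cnj (sgn (ip S f g))"
  have "ip S f g * cnj (ip S f g) =
      complex_of_real (cmod (ip S f g)) * complex_of_real (cmod (ip S f g))"
    using complex_norm_square[of "ip S f g"] by (simp only: power2_eq_square of_real_mult)
  then have "c * ip S f g = cmod (ip S f g)"
    using False by (simp add: c_def sgn_eq mult.commute)
  then have "cmod (ip S f g) = Re (ip S (\<lambda>p. c * f p) g)"
    using assms by (simp add: ip_scale)
  also have "\<dots> \<le> cmod c * fnorm S f * fnorm S g"
    using Re_ip_le[OF scale_closed[OF assms(1)] assms(2)] assms by (simp add: fnorm_scale)
  also have "cmod c = 1"
    using False by (simp add: c_def norm_sgn)
  finally show ?thesis by simp
qed

section \<open>Riesz representation and normalized kernels\<close>

text \<open>
  The Riesz representer of the evaluation at \<open>p\<close> is obtained as the maximizer of the strictly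
  concave functional \<open>2 Re f(p) - \<parallel>f\<parallel>\<^sup>2\<close>.
\<close>

lemma kernel_exists:
  assumes p: "p \<in> pts S"
  shows "\<exists>k\<in>funs S. \<forall>f\<in>funs S. f p = ip S f k"
proof -
  define \<Phi> where "\<Phi> f = 2 * Re (f p) - (fnorm S f)\<^sup>2" for f
  obtain C where C: "\<And>f. f \<in> funs S \<Longrightarrow> cmod (f p) \<le> C * fnorm S f"
    using eval_bounded[OF p] by blast
  \<comment> \<open>Completing the square: \<open>2 C s - s^2\<close> never exceeds
    \<open>C^2\<close>.\<close>
  have bdd: "bdd_above (\<Phi> ` funs S)"
  proof (rule bdd_aboveI2)
    fix f assume f: "f \<in> funs S"
    have "Re (f p) \<le> C * fnorm S f"
      using C[OF f] complex_Re_le_cmod order_trans by blast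
    moreover have "0 \<le> (C - fnorm S f)\<^sup>2" by simp
    ultimately show "\<Phi> f \<le> C\<^sup>2"
      by (simp add: \<Phi>_def power2_diff)
  qed
  define M where "M = Sup (\<Phi> ` funs S)"
  have le_M: "\<Phi> f \<le> M" if "f \<in> funs S" for f
    unfolding M_def using that bdd by (intro cSup_upper) auto
  have \<Phi>_add: "\<Phi> (\<lambda>q. f q + g q) = \<Phi> f + 2 * Re (g p) - 2 * Re (ip S g f) - (fnorm S g)\<^sup>2"
    if "f \<in> funs S" "g \<in> funs S" for f g
    using that by (simp add: \<Phi>_def fnorm_sq_add)
  \<comment> \<open>By the parallelogram law, the value of \<open>\<Phi>\<close> at the midpoint
    exceeds the mean of its values at \<open>f\<close> and \<open>g\<close> by a quarter of the
    squared distance, and it is at most \<open>M\<close>.\<close>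
  have parallel: "(fnorm S (\<lambda>q. f q - g q))\<^sup>2 \<le> 2 * (2 * M - \<Phi> f - \<Phi> g)"
    if f: "f \<in> funs S" and g: "g \<in> funs S" for f g
  proof -
    have "\<Phi> (\<lambda>q. (1/2) * (f q + g q)) \<le> M"
      using f g by (intro le_M scale_closed add_closed)
    moreover have "\<Phi> (\<lambda>q. (1/2) * (f q + g q)) = Re (f p) + Re (g p)
        - ((fnorm S f)\<^sup>2 + 2 * Re (ip S g f) + (fnorm S g)\<^sup>2) / 4"
      using f g unfolding \<Phi>_def
      by (subst fnorm_scale)
        (simp_all add: add_closed fnorm_sq_add power_mult_distrib power_divide)
    moreover have "(fnorm S (\<lambda>q. f q - g q))\<^sup>2 = (fnorm S f)\<^sup>2 - 2 * Re (ip S g f) + (fnorm S g)\<^sup>2"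
      using fnorm_sq_add[OF f scale_closed[OF g, of "-1"]] f g ip_scale[OF g f, of "-1"]
        fnorm_scale[OF g, of "-1"] by simp
    ultimately show ?thesis
      unfolding \<Phi>_def by argo
  qed
  have "\<exists>f\<in>funs S. M - 1 / real (Suc m) < \<Phi> f" for m
  proof -
    have "M - 1 / real (Suc m) < Sup (\<Phi> ` funs S)" by (simp add: M_def)
    then show ?thesis
      using less_cSup_iff[of "\<Phi> ` funs S"] bdd zero_closed by blast
  qed
  then obtain F where F: "\<And>m. F m \<in> funs S" and F_lim: "\<And>m. M - 1 / real (Suc m) < \<Phi> (F m)"
    by metis
  have cauchy: "\<exists>N. \<forall>m\<ge>N. \<forall>n\<ge>N. fnorm S (\<lambda>q. F m q - F n q) < e" if e: "e > 0" for e
  proof -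
    \<comment> \<open>Two deficits below \<open>e^2 / 4\<close>, doubled by \<open>parallel\<close>,
      keep the squared distance below \<open>e^2\<close>.\<close>
    obtain N where N: "1 / real (Suc N) < e\<^sup>2 / 4"
      using reals_Archimedean[of "e\<^sup>2 / 4"] e by (auto simp: inverse_eq_divide)
    have "fnorm S (\<lambda>q. F m q - F n q) < e" if mn: "m \<ge> N" "n \<ge> N" for m n
    proof -
      have "1 / real (Suc m) \<le> 1 / real (Suc N)" "1 / real (Suc n) \<le> 1 / real (Suc N)"
        using mn by (simp_all add: frac_le)
      then have "2 * (2 * M - \<Phi> (F m) - \<Phi> (F n)) < e\<^sup>2"
        using F_lim[of m] F_lim[of n] N by argo
      then have "(fnorm S (\<lambda>q. F m q - F n q))\<^sup>2 < e\<^sup>2"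
        using parallel[OF F F, of m n] by linarith
      then show ?thesis
        using e by (intro power2_less_imp_less[of _ e]) simp_all
    qed
    then show ?thesis by blast
  qed
  obtain k where k: "k \<in> funs S" and k_lim: "(\<lambda>m. fnorm S (\<lambda>q. F m q - k q)) \<longlonglongrightarrow> 0"
    using complete[OF F cauchy] by blast
  \<comment> \<open>Expand \<open>\<Phi> (F m)\<close> around \<open>k\<close>: bounded evaluation
    controls the first linear term, Cauchy-Schwarz the second, and the square enters with a
    favourable sign. All errors tend to 0.\<close>
  have k_max: "M \<le> \<Phi> k"
  proof (rule tendsto_lowerbound)
    let ?d = "\<lambda>m. fnorm S (\<lambda>q. F m q - k q)"
    have "(\<lambda>m. \<Phi> k + 2 * (C * ?d m) + 2 * (?d m * fnorm S k) + 1 / real (Suc m))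
        \<longlonglongrightarrow> \<Phi> k + 2 * (C * 0) + 2 * (0 * fnorm S k) + 0"
      by (intro tendsto_intros k_lim LIMSEQ_Suc[OF lim_1_over_n])
    then show "(\<lambda>m. \<Phi> k + 2 * (C * ?d m) + 2 * (?d m * fnorm S k) + 1 / real (Suc m)) \<longlonglongrightarrow> \<Phi> k"
      by simp
    have "M \<le> \<Phi> k + 2 * (C * ?d m) + 2 * (?d m * fnorm S k) + 1 / real (Suc m)" for m
    proof -
      let ?u = "\<lambda>q. F m q - k q"
      have u: "?u \<in> funs S" using F k by (rule diff_closed)
      have "\<Phi> (F m) = \<Phi> k + 2 * Re (?u p) - 2 * Re (ip S ?u k) - (?d m)\<^sup>2"
        using \<Phi>_add[OF k u] by simp
      moreover have "Re (?u p) \<le> C * ?d m"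
        using C[OF u] complex_Re_le_cmod order_trans by blast
      moreover have "- Re (ip S ?u k) \<le> ?d m * fnorm S k"
        using cmod_ip_le[OF u k] abs_Re_le_cmod[of "ip S ?u k"] by linarith
      moreover have "0 \<le> (?d m)\<^sup>2" by simp
      ultimately show ?thesis
        using F_lim[of m] by linarith
    qed
    then show "\<forall>\<^sub>F m in sequentially.
        M \<le> \<Phi> k + 2 * (C * ?d m) + 2 * (?d m * fnorm S k) + 1 / real (Suc m)"
      by simp
  qed simp
  \<comment> \<open>First variation: moving from the maximizer \<open>k\<close> in the direction
    \<open>g\<close> by a real step \<open>t\<close> cannot increase \<open>\<Phi>\<close>, which
    forces the linear coefficient \<open>r\<close> to vanish.\<close>
  have Re_eq: "Re (g p) = Re (ip S g k)" if g: "g \<in> funs S" for g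
  proof -
    define r where "r = Re (g p) - Re (ip S g k)"
    have var: "2 * t * r \<le> t\<^sup>2 * (fnorm S g)\<^sup>2" for t
    proof -
      have tg: "(\<lambda>q. complex_of_real t * g q) \<in> funs S" using g by (rule scale_closed)
      have "\<Phi> (\<lambda>q. k q + complex_of_real t * g q) \<le> \<Phi> k"
        using le_M[OF add_closed[OF k tg]] k_max by simp
      then show ?thesis
        using \<Phi>_add[OF k tg] g k
        by (simp add: ip_scale fnorm_scale power_mult_distrib r_def algebra_simps)
    qed
    \<comment> \<open>The added 1 keeps the divisor positive even for \<open>g = 0\<close>; the step
      \<open>t = r / N\<close> then gives \<open>2 r^2 / N \<le> r^2 / N\<close>.\<close>
    define N where "N = (fnorm S g)\<^sup>2 + 1"
    have N: "N > 0" "(fnorm S g)\<^sup>2 \<le> N" by (simp_all add: N_def add_nonneg_pos)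
    have "2 * (r / N) * r \<le> (r / N)\<^sup>2 * N"
      using var[of "r / N"] mult_left_mono[OF N(2) zero_le_power2[of "r / N"]] by linarith
    then have "r\<^sup>2 \<le> 0"
      using N(1) by (simp add: power2_eq_square field_simps)
    then show ?thesis by (simp add: r_def)
  qed
  \<comment> \<open>The real-part identity for \<open>\<i> g\<close> supplies the imaginary
    parts.\<close>
  have "g p = ip S g k" if g: "g \<in> funs S" for g
    using Re_eq[OF g] Re_eq[OF scale_closed[OF g, of \<i>]] g k
    by (simp add: ip_scale complex_eq_iff)
  then show ?thesis using k by blast
qed

text \<open>The definite description is proper: a representer exists, and the difference of two
  representers is orthogonal to itself.\<close>

lemma rep_kernel_in_funs:
  assumes p: "p \<in> pts S"
  shows "rep_kernel S p \<in> funs S"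
proof -
  obtain k where k: "k \<in> funs S" "\<And>f. f \<in> funs S \<Longrightarrow> f p = ip S f k"
    using kernel_exists[OF p] by blast
  have "k' = k" if k': "k' \<in> funs S" "\<forall>f\<in>funs S. f p = ip S f k'" for k'
  proof (rule ccontr)
    assume "k' \<noteq> k"
    let ?d = "\<lambda>q. k' q - k q"
    have d: "?d \<in> funs S" using k'(1) k(1) by (rule diff_closed)
    have "?d \<noteq> (\<lambda>q. 0)" using \<open>k' \<noteq> k\<close> by (auto simp: fun_eq_iff)
    then have "0 < Re (ip S ?d ?d)" using d ip_pos by blast
    \<comment> \<open>Both sides are the conjugate of the value of the difference at
      \<open>p\<close>.\<close>
    moreover have "ip S k' ?d = ip S k ?d"
      using k(2)[OF d] k'(2)[rule_format, OF d] ip_cnj[OF d k'(1)] ip_cnj[OF d k(1)]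
      by (simp only:)
    then have "ip S ?d ?d = 0"
      using ip_diff[OF k'(1) k(1) d] by simp
    ultimately show False by simp
  qed
  then have "rep_kernel S p = k"
    unfolding rep_kernel_def using k by (intro the_equality) blast+
  then show ?thesis using k(1) by simp
qed

lemma fnorm_rep_kernel_pos: "p \<in> pts S \<Longrightarrow> 0 < fnorm S (rep_kernel S p)"
  using ip_pos[OF rep_kernel_in_funs kernel_nonzero] by (simp add: fnorm_def)

lemma nkernel_eq:
  "nkernel S p = (\<lambda>q. complex_of_real (1 / fnorm S (rep_kernel S p)) * rep_kernel S p q)"
  by (simp add: nkernel_def)

lemma nkernel_in_funs: "p \<in> pts S \<Longrightarrow> nkernel S p \<in> funs S"
  unfolding nkernel_eq by (intro scale_closed rep_kernel_in_funs)

lemma fnorm_nkernel: "p \<in> pts S \<Longrightarrow> fnorm S (nkernel S p) = 1"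
  unfolding nkernel_eq using fnorm_rep_kernel_pos[of p]
  by (subst fnorm_scale) (simp_all add: rep_kernel_in_funs norm_divide)

end

text \<open>A real \<open>Sup\<close> bounds its set only if that set is bounded above. Here an
  operator bound \<open>C\<close> is an upper bound, by Cauchy-Schwarz and the unit length of
  normalized kernels.\<close>

lemma berezin_norm_upper:
  assumes "rkhs S" "rkhs S'" "bounded_op S S' T" "p \<in> pts S" "q \<in> pts S'"
  shows "cmod (ip S' (T (nkernel S p)) (nkernel S' q)) \<le> berezin_norm S S' T"
proof -
  interpret S: rkhs S by fact
  interpret S': rkhs S' by fact
  have T: "\<And>f. f \<in> funs S \<Longrightarrow> T f \<in> funs S'"
    using assms(3) by (auto simp: bounded_op_def)
  obtain C where C: "\<And>f. f \<in> funs S \<Longrightarrow> fnorm S' (T f) \<le> C * fnorm S f"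
    using assms(3) unfolding bounded_op_def by blast
  have "cmod (ip S' (T (nkernel S p)) (nkernel S' q)) \<le> C" if "p \<in> pts S" "q \<in> pts S'" for p q
    using S'.cmod_ip_le[OF T S'.nkernel_in_funs, of "nkernel S p" q] C[of "nkernel S p"] that
      S.nkernel_in_funs S.fnorm_nkernel S'.fnorm_nkernel by force
  then have "bdd_above {cmod (ip S' (T (nkernel S p)) (nkernel S' q)) | p q.
      p \<in> pts S \<and> q \<in> pts S'}"
    by (intro bdd_aboveI) auto
  then show ?thesis
    unfolding berezin_norm_def using assms(4,5) by (intro cSup_upper) auto
qed

section \<open>Normalized kernels of the direct sum and the expansion of the form\<close>

definition kernel_weight :: "('n::finite \<Rightarrow> 'a fun_space) \<Rightarrow> ('n \<Rightarrow> 'a) \<Rightarrow> 'n \<Rightarrow> real" where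
  "kernel_weight H l i = fnorm (H i) (rep_kernel (H i) (l i)) /
     sqrt (\<Sum>j\<in>UNIV. (fnorm (H j) (rep_kernel (H j) (l j)))\<^sup>2)"

context
  fixes H :: "'n::finite \<Rightarrow> 'a fun_space"
  assumes H: "\<And>i. rkhs (H i)"
begin

text \<open>The norm of the summand's kernel is nonzero, so it can be moved from the normalized
  kernel into the weight.\<close>

lemma dsum_nkernel_eq:
  assumes "l \<in> dsum_pts H"
  shows "dsum_nkernel H l i = (\<lambda>q. complex_of_real (kernel_weight H l i) * nkernel (H i) (l i) q)"
proof -
  have "0 < fnorm (H i) (rep_kernel (H i) (l i))"
    using assms by (intro rkhs.fnorm_rep_kernel_pos[OF H]) (simp add: dsum_pts_def)
  then show ?thesis
    by (simp add: dsum_nkernel_def kernel_weight_def nkernel_def)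
qed

lemma kernel_weight_nonneg: "l \<in> dsum_pts H \<Longrightarrow> 0 \<le> kernel_weight H l i"
  unfolding kernel_weight_def dsum_pts_def
  by (auto intro!: divide_nonneg_nonneg sum_nonneg rkhs.fnorm_nonneg[OF H]
      rkhs.rep_kernel_in_funs[OF H])

lemma sum_kernel_weight_sq:
  assumes "l \<in> dsum_pts H"
  shows "(\<Sum>i\<in>UNIV. (kernel_weight H l i)\<^sup>2) = 1"
proof -
  have "0 < fnorm (H j) (rep_kernel (H j) (l j))" for j
    using assms by (intro rkhs.fnorm_rep_kernel_pos[OF H]) (simp add: dsum_pts_def)
  then have "0 < (\<Sum>j\<in>UNIV. (fnorm (H j) (rep_kernel (H j) (l j)))\<^sup>2)"
    by (intro sum_pos zero_less_power) simp_all
  then show ?thesis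
    by (simp add: kernel_weight_def power_divide sum_divide_distrib[symmetric])
qed

text \<open>Sesquilinear expansion in both tuples; the weights are real, so conjugation in the
  second slot leaves them unchanged.\<close>

lemma dsum_ip_op_matrix:
  assumes A: "\<And>i j. bounded_op (H j) (H i) (A i j)"
    and l: "l \<in> dsum_pts H" and m: "m \<in> dsum_pts H"
  shows "dsum_ip H (op_matrix A (dsum_nkernel H l)) (dsum_nkernel H m) =
    (\<Sum>i\<in>UNIV. \<Sum>j\<in>UNIV. complex_of_real (kernel_weight H m i * kernel_weight H l j) *
      ip (H i) (A i j (nkernel (H j) (l j))) (nkernel (H i) (m i)))"
proof -
  have "ip (H i) (op_matrix A (dsum_nkernel H l) i) (dsum_nkernel H m i) =
    (\<Sum>j\<in>UNIV. complex_of_real (kernel_weight H m i * kernel_weight H l j) *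
      ip (H i) (A i j (nkernel (H j) (l j))) (nkernel (H i) (m i)))" for i
  proof -
    interpret rkhs "H i" by (rule H)
    have nl: "nkernel (H j) (l j) \<in> funs (H j)" for j
      using l by (intro rkhs.nkernel_in_funs[OF H]) (simp add: dsum_pts_def)
    have nm: "nkernel (H i) (m i) \<in> funs (H i)"
      using m by (intro nkernel_in_funs) (simp add: dsum_pts_def)
    have An: "A i j (nkernel (H j) (l j)) \<in> funs (H i)" for j
      using A[of j i] nl unfolding bounded_op_def by blast
    have lin: "A i j (dsum_nkernel H l j) =
        (\<lambda>q. complex_of_real (kernel_weight H l j) * A i j (nkernel (H j) (l j)) q)" for j
      using A[of j i] nl[of j] unfolding dsum_nkernel_eq[OF l] bounded_op_def by simp
    have in_funs: "A i j (dsum_nkernel H l j) \<in> funs (H i)" for j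
      unfolding lin using An by (rule scale_closed)
    have "ip (H i) (op_matrix A (dsum_nkernel H l) i) (dsum_nkernel H m i) =
        (\<Sum>j\<in>UNIV. ip (H i) (A i j (dsum_nkernel H l j)) (dsum_nkernel H m i))"
      unfolding op_matrix_def dsum_nkernel_eq[OF m] using in_funs nm
      by (intro ip_sum[THEN conjunct2] scale_closed) auto
    then show ?thesis
      unfolding lin dsum_nkernel_eq[OF m] using An nm
      by (simp add: ip_scale ip_scale_right scale_closed mult_ac)
  qed
  then show ?thesis by (simp add: dsum_ip_def)
qed

end

section \<open>Real bilinear forms and the operator norm of a matrix\<close>

lemma real_bilinear_le_onorm:
  fixes B :: "'n::finite \<Rightarrow> 'm::finite \<Rightarrow> real"
  shows "(\<Sum>i\<in>UNIV. \<Sum>j\<in>UNIV. b i * a j * B i j) \<le>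
    onorm (\<lambda>v::complex^'m. (\<chi> i j. complex_of_real (B i j)) *v v) *
      sqrt (\<Sum>j\<in>UNIV. (a j)\<^sup>2) * sqrt (\<Sum>i\<in>UNIV. (b i)\<^sup>2)"
proof -
  define M :: "complex^'m^'n" where "M = (\<chi> i j. complex_of_real (B i j))"
  define x :: "complex^'m" where "x = (\<chi> j. complex_of_real (a j))"
  define y :: "complex^'n" where "y = (\<chi> i. complex_of_real (b i))"
  \<comment> \<open>\<open>onorm\<close> refers to the real normed space structure, so linearity is
    checked over real scalars.\<close>
  have lin: "linear (\<lambda>v. M *v v)"
    by (rule linearI)
      (simp_all add: matrix_vector_mult_def vec_eq_iff scaleR_sum_right distrib_left sum.distrib)
  \<comment> \<open>The real inner product of complex vectors is the real part of the Hermitian one;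
    for the real entries here it is the double sum itself.\<close>
  have "(\<Sum>i\<in>UNIV. \<Sum>j\<in>UNIV. b i * a j * B i j) = (M *v x) \<bullet> y"
    by (simp add: inner_vec_def matrix_vector_mult_def M_def x_def y_def inner_complex_def
        sum_distrib_left mult_ac)
  also have "\<dots> \<le> norm (M *v x) * norm y"
    by (rule norm_cauchy_schwarz)
  also have "\<dots> \<le> onorm (\<lambda>v. M *v v) * norm x * norm y"
    using lin by (intro mult_right_mono onorm) (auto simp: linear_conv_bounded_linear)
  finally show ?thesis
    by (simp add: M_def x_def y_def norm_vec_def L2_set_def)
qed

theorem theorem2p13:
  fixes H :: "'n::finite \<Rightarrow> 'a fun_space"
    and A :: "'n \<Rightarrow> 'n \<Rightarrow> ('a \<Rightarrow> complex) \<Rightarrow> ('a \<Rightarrow> complex)"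
  assumes "\<And>i. rkhs (H i)"
    and "\<And>i j. bounded_op (H j) (H i) (A i j)"
  shows "dsum_berezin_norm H (op_matrix A) \<le>
    onorm (\<lambda>v::complex^'n. (\<chi> i j. complex_of_real (berezin_norm (H j) (H i) (A i j))) *v v)"
    (is "_ \<le> ?N")
proof -
  have bound: "cmod (dsum_ip H (op_matrix A (dsum_nkernel H l)) (dsum_nkernel H m)) \<le> ?N"
    if l: "l \<in> dsum_pts H" and m: "m \<in> dsum_pts H" for l m
  proof -
    let ?a = "kernel_weight H l" and ?b = "kernel_weight H m"
    note nonneg = kernel_weight_nonneg[OF assms(1) l] kernel_weight_nonneg[OF assms(1) m]
    have "cmod (dsum_ip H (op_matrix A (dsum_nkernel H l)) (dsum_nkernel H m)) \<le>
        (\<Sum>i\<in>UNIV. \<Sum>j\<in>UNIV. ?b i * ?a j * berezin_norm (H j) (H i) (A i j))"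
      unfolding dsum_ip_op_matrix[OF assms l m]
    \<comment> \<open>The triangle inequality is applied to both sums; the weights are nonnegative
      and pass through the modulus.\<close>
    proof (intro sum_norm_le)
      fix i j
      have "cmod (ip (H i) (A i j (nkernel (H j) (l j))) (nkernel (H i) (m i))) \<le>
          berezin_norm (H j) (H i) (A i j)"
        using l m by (intro berezin_norm_upper assms) (simp_all add: dsum_pts_def)
      then show "cmod (complex_of_real (?b i * ?a j) *
          ip (H i) (A i j (nkernel (H j) (l j))) (nkernel (H i) (m i))) \<le>
          ?b i * ?a j * berezin_norm (H j) (H i) (A i j)"
        using nonneg by (simp add: norm_mult mult_left_mono)
    qed
    also have "\<dots> \<le> ?N"
      using real_bilinear_le_onorm[of ?b ?a "\<lambda>i j. berezin_norm (H j) (H i) (A i j)"]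
      by (simp add: sum_kernel_weight_sq[OF assms(1) l] sum_kernel_weight_sq[OF assms(1) m])
    finally show ?thesis .
  qed
  \<comment> \<open>A bound on every element bounds a real \<open>Sup\<close> only when the set is
    nonempty, so a point of the product is chosen.\<close>
  have "\<exists>l. l \<in> dsum_pts H"
    using rkhs.pts_nonempty[OF assms(1)] by (auto simp: dsum_pts_def intro!: choice)
  then show ?thesis
    unfolding dsum_berezin_norm_def using bound by (intro cSup_least) blast+
qed

end
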